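(* Let $M$ be an arbitrary $d\times d$ matrix dilation, $m=|\det M|$, $c\in\frac12\mathbb Z^d$, $n\in\mathbb N$, and let $\lambda'_\alpha\in\mathbb C$, $\alpha\in\Delta_n$, satisfy $\lambda'_{\mathbf 0}=1$, $\mathrm{Re}\,\lambda'_\alpha=0$ if $[\alpha]$ is odd, and $\mathrm{Im}\,\lambda'_\alpha=0$ if $[\alpha]$ is even. Then there exists a mask $m_0$ which is symmetric with respect to the point $c$ in the sense (b), i.e. $m_0(\xi)=e^{2\pi i(2c,\xi)}\overline{m_0(\xi)}$, and whose polyphase components $\mu_{0k}$ satisfy $$D^\beta\mu_{0k}(\mathbf 0)=\frac{(2\pi i)^{[\beta]}}{\sqrt m}\sum_{\alpha\in\mathbb Z^d_+,\,\alpha\le\beta}\lambda_\alpha\binom{\beta}{\alpha}(-M^{-1}s_k)^{\beta-\alpha}\qquad\forall\beta\in\Delta_n,\ \forall k=0,\dots,m-1,$$ with the numbers $$\lambda_\alpha=\sum_{\gamma\in\mathbb Z^d_+,\,\gamma\le\alpha}\lambda'_\gamma\binom{\alpha}{\gamma}(M^{-1}c)^{\alpha-\gamma},\qquad\alpha\in\Delta_n.$$ The mask $m_0$ can be represented by $$m_0(\xi)=\frac1m\sum_{j\in J}\sum_{\beta\in\Delta_n}\lambda'_\beta G^B_{\beta j}(M^*\xi)e^{2\pi i(c,\xi)}$$ $$+\frac1m\sum_{i\in I^1}\Bigg[\sum_{\beta\in\Delta_n}\Big(\sum_{\gamma\in\mathbb Z^d_+,\,\gamma\le\beta}\lambda'_\gamma\binom{\beta}{\gamma}(M^{-1}c-M^{-1}s_i)^{\beta-\gamma}\Big)G_{\beta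 i}(M^*\xi)e^{2\pi i(s_i,\xi)}$$ $$+\sum_{\beta\in\Delta_n}\Big(\sum_{\gamma\in\mathbb Z^d_+,\,\gamma\le\beta}\overline{\lambda'_\gamma}\binom{\beta}{\gamma}(M^{-1}c-M^{-1}s_i)^{\beta-\gamma}\Big)\overline{G_{\beta i}(M^*\xi)}\,e^{2\pi i(2c-s_i,\xi)}\Bigg],$$ where $G_{\beta i}\in\Theta_{\beta,n}$, $\beta\in\Delta_n$, $i\in I^1$, are trigonometric polynomials, and $G^B_{\beta j}\in\Theta^B_{\beta,n}$, $\beta\in\Delta_n$, $j\in J$, are trigonometric polynomials of semi-integer degrees associated with $\sigma=M^{-1}(c-s_j)-\lfloor M^{-1}(c-s_j)\rfloor$.
   Context: Notation: $\mathbb Z^d_+=\{x\in\mathbb Z^d:x\ge\mathbf 0\}$, inequalities and floor of vectors are coordinatewise; $[\alpha]=\sum_j\alpha_j$; $\binom{\beta}{\gamma}=\beta!/(\gamma!(\beta-\gamma)!)$, $a^b=\prod_j a_j^{b_j}$; $\Delta_n=\{\alpha\in\mathbb Z^d_+:[\alpha]<n\}$. Functions are considered for $\xi\in\mathbb R^d$. A matrix dilation $M$ is an integer $d\times d$ matrix all of whose eigenvalues are bigger than 1 in modulus; $M^*$ is its conjugate (transpose). A set of digits $D(M)=\{s_0,\dots,s_{m-1}\}$ contains exactly one representative of each coset of $\mathbb Z^d/M\mathbb Z^d$. A trigonometric polynomial of semi-integer degrees associated with $\sigma\in\frac12\mathbb Z^d\cap[0,\frac12]^d$ is a finite sum $\sum_{k\in\mathbb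 Z^d}h_ke^{2\pi i(k+\sigma,\xi)}$, $h_k\in\mathbb C$; a trigonometric polynomial is the case $\sigma=\mathbf 0$. A mask is a trigonometric polynomial $m_0$ with $m_0(\mathbf 0)=1$; its polyphase components are the unique trigonometric polynomials $\mu_{0k}$ with $m_0(\xi)=\frac1{\sqrt m}\sum_{k=0}^{m-1}e^{2\pi i(s_k,\xi)}\mu_{0k}(M^*\xi)$. Index sets: for each $k\in\{0,\dots,m-1\}$ there is a unique $l\in\{0,\dots,m-1\}$ with $M^{-1}(2c-s_k-s_l)\in\mathbb Z^d$. $J$ is the set of those $k$ for which $l=k$; $I$ is the set of those $k$ for which $l\ne k$, and for $i\in I$ the corresponding $l$ is denoted $i'$ (also in $I$). The digits are chosen so that $s_i+s_{i'}=2c$ for all $i\in I$. $I=I^1\cup I^2$ is a disjoint splitting such that $i\in I^1$ iff $i'\in I^2$. $\Theta_{\beta,n}$ (for $\beta\in\Delta_n$) is the class of trigonometric polynomials $t$ of integer or semi-integer degrees with $D^\alpha t(\mathbf 0)=(2\pi i)^{[\alpha]}\delta_{\alpha\beta}$ for all $\alpha\in\Delta_n$; $\Theta^B_{\beta,n}=\{t\in\Theta_{\beta,n}:t(\xi)=(-1)^{[\beta]}\overline{t(\xi)}\}$. *)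

theory Defs
  imports "HOL-Analysis.Analysis"
begin

(* Z^d is the type (int, 'd) vec, Z^d_+ is (nat, 'd) vec with its coordinatewise order,
   and functions of xi in R^d are complex-valued functions on (real, 'd) vec. *)

definition rvec :: "int^'d \<Rightarrow> real^'d" where
  "rvec k = (\<chi> j. real_of_int (k $ j))"

definition int_vec :: "real^'d \<Rightarrow> bool" where
  "int_vec x \<longleftrightarrow> (\<forall>j. x $ j \<in> \<int>)"

definition half_int_vec :: "real^'d \<Rightarrow> bool" where
  "half_int_vec x \<longleftrightarrow> (\<forall>j. 2 * x $ j \<in> \<int>)"

definition floor_vec :: "real^'d \<Rightarrow> int^'d" where
  "floor_vec x = (\<chi> j. \<lfloor>x $ j\<rfloor>)"

definition mdeg :: "nat^'d \<Rightarrow> nat" where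
  "mdeg \<alpha> = (\<Sum>j\<in>UNIV. \<alpha> $ j)"

definition Delta :: "nat \<Rightarrow> (nat^'d) set" where
  "Delta n = {\<alpha>. mdeg \<alpha> < n}"

definition mfact :: "nat^'d \<Rightarrow> nat" where
  "mfact \<beta> = (\<Prod>j\<in>UNIV. fact (\<beta> $ j))"

definition mbinom :: "nat^'d \<Rightarrow> nat^'d \<Rightarrow> nat" where
  "mbinom \<beta> \<gamma> = (\<Prod>j\<in>UNIV. (\<beta> $ j) choose (\<gamma> $ j))"

lemma mbinom_mfact:
  fixes \<beta> \<gamma> :: "nat^'d"
  assumes "\<gamma> \<le> \<beta>"
  shows "real (mbinom \<beta> \<gamma>) = real (mfact \<beta>) / (real (mfact \<gamma>) * real (mfact (\<beta> - \<gamma>)))"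
proof -
  have "\<gamma> $ j \<le> \<beta> $ j" for j
    using assms by (simp add: less_eq_vec_def)
  then show ?thesis
    unfolding mbinom_def mfact_def
    by (simp add: binomial_fact prod.distrib prod_dividef)
qed

definition mpow :: "real^'d \<Rightarrow> nat^'d \<Rightarrow> real" where
  "mpow a b = (\<Prod>j\<in>UNIV. (a $ j) ^ (b $ j))"

definition partial :: "'d \<Rightarrow> (real^'d \<Rightarrow> complex) \<Rightarrow> (real^'d \<Rightarrow> complex)" where
  "partial j f = (\<lambda>x. vector_derivative (\<lambda>t. f (x + t *\<^sub>R axis j 1)) (at 0))"

(* The mixed derivative of multi-index \<alpha>. The coordinates are processed in some fixed order;
   it does not matter which one, as the functions differentiated here are smooth. *)
definition mderiv :: "nat^'d \<Rightarrow> (real^'d \<Rightarrow> complex) \<Rightarrow> (real^'d \<Rightarrow> complex)" where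
  "mderiv \<alpha> f =
     fold (\<lambda>j. partial j ^^ (\<alpha> $ j)) (SOME js. set js = (UNIV :: 'd set) \<and> distinct js) f"

definition rmat :: "int^'d^'d \<Rightarrow> real^'d^'d" where
  "rmat M = map_matrix real_of_int M"

definition Minv :: "int^'d^'d \<Rightarrow> real^'d \<Rightarrow> real^'d" where
  "Minv M x = matrix_inv (rmat M) *v x"

definition Mstar :: "int^'d^'d \<Rightarrow> real^'d \<Rightarrow> real^'d" where
  "Mstar M x = transpose (rmat M) *v x"

definition matrix_dilation :: "int^'d^'d \<Rightarrow> bool" where
  "matrix_dilation M \<longleftrightarrow>
     (\<forall>(l :: complex) v. v \<noteq> 0 \<and> map_matrix of_int M *v v = l *s v \<longrightarrow> norm l > 1)"

definition digit_set :: "int^'d^'d \<Rightarrow> nat \<Rightarrow> (nat \<Rightarrow> int^'d) \<Rightarrow> bool" where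
  "digit_set M m s \<longleftrightarrow> (\<forall>x. \<exists>!k. k < m \<and> x - s k \<in> range (\<lambda>y. M *v y))"

definition expw :: "real^'d \<Rightarrow> real^'d \<Rightarrow> complex" where
  "expw a \<xi> = exp (2 * of_real pi * \<i> * of_real (a \<bullet> \<xi>))"

definition semi_trig_poly :: "real^'d \<Rightarrow> (real^'d \<Rightarrow> complex) \<Rightarrow> bool" where
  "semi_trig_poly \<sigma> t \<longleftrightarrow>
     half_int_vec \<sigma> \<and> (\<forall>j. 0 \<le> \<sigma> $ j \<and> \<sigma> $ j \<le> 1/2) \<and>
     (\<exists>h :: int^'d \<Rightarrow> complex. finite {k. h k \<noteq> 0} \<and>
        (\<forall>\<xi>. t \<xi> = (\<Sum>k | h k \<noteq> 0. h k * expw (rvec k + \<sigma>) \<xi>)))"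

definition trig_poly :: "(real^'d \<Rightarrow> complex) \<Rightarrow> bool" where
  "trig_poly t \<longleftrightarrow> semi_trig_poly 0 t"

definition is_mask :: "(real^'d \<Rightarrow> complex) \<Rightarrow> bool" where
  "is_mask m0 \<longleftrightarrow> trig_poly m0 \<and> m0 0 = 1"

definition symmetric_b :: "real^'d \<Rightarrow> (real^'d \<Rightarrow> complex) \<Rightarrow> bool" where
  "symmetric_b c m0 \<longleftrightarrow> (\<forall>\<xi>. m0 \<xi> = expw (2 *\<^sub>R c) \<xi> * cnj (m0 \<xi>))"

(* For a digit set s these conditions determine mu k for all k < m. *)
definition polyphase ::
  "int^'d^'d \<Rightarrow> nat \<Rightarrow> (nat \<Rightarrow> int^'d) \<Rightarrow> (real^'d \<Rightarrow> complex) \<Rightarrow> (nat \<Rightarrow> real^'d \<Rightarrow> complex) \<Rightarrow> bool"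
  where
  "polyphase M m s m0 \<mu> \<longleftrightarrow>
     (\<forall>k<m. trig_poly (\<mu> k)) \<and>
     (\<forall>\<xi>. m0 \<xi> = 1 / of_real (sqrt (real m)) *
             (\<Sum>k<m. expw (rvec (s k)) \<xi> * \<mu> k (Mstar M \<xi>)))"

(* The digit index paired with k; unique existence holds when s is a digit set and 2c is integral. *)
definition partner ::
  "int^'d^'d \<Rightarrow> nat \<Rightarrow> (nat \<Rightarrow> int^'d) \<Rightarrow> real^'d \<Rightarrow> nat \<Rightarrow> nat" where
  "partner M m s c k =
     (THE l. l < m \<and> int_vec (Minv M (2 *\<^sub>R c - rvec (s k) - rvec (s l))))"

definition Jset :: "int^'d^'d \<Rightarrow> nat \<Rightarrow> (nat \<Rightarrow> int^'d) \<Rightarrow> real^'d \<Rightarrow> nat set" where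
  "Jset M m s c = {k. k < m \<and> partner M m s c k = k}"

definition Iset :: "int^'d^'d \<Rightarrow> nat \<Rightarrow> (nat \<Rightarrow> int^'d) \<Rightarrow> real^'d \<Rightarrow> nat set" where
  "Iset M m s c = {k. k < m \<and> partner M m s c k \<noteq> k}"

definition Theta :: "nat^'d \<Rightarrow> nat \<Rightarrow> (real^'d \<Rightarrow> complex) set" where
  "Theta \<beta> n = {t. (\<exists>\<sigma>. semi_trig_poly \<sigma> t) \<and>
     (\<forall>\<alpha>\<in>Delta n. mderiv \<alpha> t 0 =
        (2 * of_real pi * \<i>) ^ mdeg \<alpha> * (if \<alpha> = \<beta> then 1 else 0))}"

definition ThetaB :: "nat^'d \<Rightarrow> nat \<Rightarrow> (real^'d \<Rightarrow> complex) set" where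
  "ThetaB \<beta> n = {t \<in> Theta \<beta> n. \<forall>\<xi>. t \<xi> = (-1) ^ mdeg \<beta> * cnj (t \<xi>)}"

end

theory Submission
  imports Defs "HOL-Computational_Algebra.Polynomial"
begin

text \<open>
  The mask is assembled from its polyphase components, so that its derivatives are prescribed
  one coset at a time. Dividing \<open>D\<^sup>\<alpha> t(0)\<close> by \<open>(2\<pi>i)\<^bsup>[\<alpha>]\<^esup>\<close> turns the derivatives of a
  trigonometric sum \<open>t(\<xi>) = \<Sum> h\<^sub>a e\<^bsup>2\<pi>i(a,\<xi>)\<^esup>\<close> into its moments \<open>\<Sum> h\<^sub>a a\<^sup>\<alpha>\<close>, and in this
  language everything becomes algebra of frequencies. Multiplying \<open>t\<close> by \<open>e\<^bsup>2\<pi>i(b,\<xi>)\<^esup>\<close> translates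
  all frequencies by \<open>b\<close>; the moments then change by the binomial shift with parameter \<open>b\<close>
  (\<open>moment_modulate\<close>). Conjugation reflects the frequencies, hence conjugates a moment and
  multiplies it by \<open>(-1)\<^bsup>[\<alpha>]\<^esup>\<close> (\<open>moment_cnj\<close>). Translating twice is translating by the sum, so binomial
  shifts compose additively (\<open>binom_shift_add\<close>). Therefore, with \<open>a\<^sub>k = M\<^sup>-\<^sup>1(c - s\<^sub>k)\<close>, the condition on
  \<open>\<mu>\<^sub>0\<^sub>k\<close> says that \<open>\<nu>\<^sub>k = \<surd>m \<mu>\<^sub>0\<^sub>k\<close> has as moments of order below \<open>n\<close> the shift of \<open>\<lambda>'\<close> by \<open>a\<^sub>k\<close>.

  Any moments of order below \<open>n\<close> can be realised with frequencies in any translate of the integer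
  lattice: in one variable this is Lagrange interpolation at \<open>n\<close> nodes (\<open>dual_to_powers\<close>), and
  products of one-dimensional coefficients do the rest (\<open>exists_dual_to_moments\<close>). If the translate
  is symmetric about the origin, averaging a solution with its signed conjugate makes it symmetric
  (\<open>exists_symmetric_dual_to_moments\<close>).

  The symmetry of the mask reads: \<open>\<nu>\<close> at the partner index of \<open>k\<close> is the conjugate of \<open>\<nu>\<^sub>k\<close>, up to an
  exponential that disappears for \<open>k \<in> I\<close> because there \<open>s\<^sub>k + s\<^sub>k\<^sub>' = 2c\<close>. For a pair \<open>i, i'\<close> one
  chooses \<open>\<nu>\<^sub>i\<close> with the right moments and puts the conjugate at \<open>i'\<close>; since \<open>a\<^sub>i\<^sub>' = - a\<^sub>i\<close>, the parity of
  \<open>\<lambda>'\<close> is exactly what makes the moments at \<open>i'\<close> come out right. For \<open>j \<in> J\<close>, where \<open>a\<^sub>j\<close> is a half-integer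
  vector, one takes \<open>\<nu>\<^sub>j = g e\<^bsup>2\<pi>i(a\<^sub>j,\<xi>)\<^esup>\<close> with \<open>g\<close> having moments \<open>\<lambda>'\<close>: the class \<open>\<Theta>\<^sup>B\<close> and the parity of
  \<open>\<lambda>'\<close> make \<open>g\<close> real, and its frequencies lie in the integer lattice translated by the
  fractional part of \<open>a\<^sub>j\<close>, so that those of \<open>\<nu>\<^sub>j\<close> are integral.
\<close>

section \<open>Multi-indices\<close>

text \<open>
  Distributivity with the choice functions written as vectors. It serves for the binomial
  identity for multi-index powers and for the factorisation of the moments of a tensor product.
\<close>

lemma prod_sum_vec:
  fixes f :: "'d::finite \<Rightarrow> 'b \<Rightarrow> 'c::comm_semiring_1"
  assumes "\<And>j. finite (B j)"
  shows "(\<Prod>j\<in>UNIV. \<Sum>x\<in>B j. f j x) = (\<Sum>v | \<forall>j. v $ j \<in> B j. \<Prod>j\<in>UNIV. f j (v $ j))"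
proof -
  have "(\<Prod>j\<in>UNIV. \<Sum>x\<in>B j. f j x) = (\<Sum>g\<in>PiE UNIV B. \<Prod>j\<in>UNIV. f j (g j))"
    using assms by (intro prod_sum_PiE) auto
  also have "\<dots> = (\<Sum>v | \<forall>j. v $ j \<in> B j. \<Prod>j\<in>UNIV. f j (v $ j))"
    by (rule sum.reindex_bij_witness[of _ "vec_nth" "vec_lambda"]) auto
  finally show ?thesis .
qed

lemma finite_vec_box:
  fixes B :: "'d::finite \<Rightarrow> 'b set"
  assumes "\<And>j. finite (B j)"
  shows "finite {v :: 'b^'d. \<forall>j. v $ j \<in> B j}"
proof -
  have "{v :: 'b^'d. \<forall>j. v $ j \<in> B j} \<subseteq> vec_lambda ` PiE UNIV B"
  proof
    fix v :: "'b^'d" assume "v \<in> {v. \<forall>j. v $ j \<in> B j}"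
    then show "v \<in> vec_lambda ` PiE UNIV B"
      by (intro image_eqI[of _ _ "vec_nth v"]) auto
  qed
  then show ?thesis
    using assms by (meson finite_PiE finite finite_imageI finite_subset)
qed

lemma atMost_multi_index: "{\<alpha>. \<alpha> \<le> \<beta>} = {\<alpha> :: nat^'d. \<forall>j. \<alpha> $ j \<in> {..\<beta> $ j}}"
  by (auto simp: less_eq_vec_def)

lemma finite_atMost_multi_index [simp]: "finite {\<alpha> :: nat^'d. \<alpha> \<le> \<beta>}"
  unfolding atMost_multi_index by (rule finite_vec_box) simp

lemma nth_le_mdeg: "\<alpha> $ j \<le> mdeg \<alpha>"
  unfolding mdeg_def by (rule member_le_sum) auto

lemma finite_Delta [simp]: "finite (Delta n :: (nat^'d) set)"
proof (rule finite_subset)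
  show "Delta n \<subseteq> {\<alpha> :: nat^'d. \<forall>j. \<alpha> $ j \<in> {..<n}}"
    using nth_le_mdeg le_less_trans by (fastforce simp: Delta_def)
qed (rule finite_vec_box, simp)

lemma mdeg_add_diff:
  fixes \<alpha> \<beta> :: "nat^'d"
  assumes "\<alpha> \<le> \<beta>"
  shows "mdeg \<alpha> + mdeg (\<beta> - \<alpha>) = mdeg \<beta>"
  using assms by (simp add: mdeg_def less_eq_vec_def sum.distrib[symmetric])

lemma Delta_downward:
  fixes \<alpha> \<beta> :: "nat^'d"
  assumes "\<alpha> \<le> \<beta>" "\<beta> \<in> Delta n"
  shows "\<alpha> \<in> Delta n"
  using mdeg_add_diff[OF assms(1)] assms(2) by (simp add: Delta_def)

lemma mpow_minus: "mpow (- x) \<alpha> = (- 1) ^ mdeg \<alpha> * mpow x \<alpha>"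
  by (simp add: mpow_def mdeg_def power_minus[of "x $ _"] prod.distrib power_sum)

lemma mpow_add:
  fixes x y :: "real^'d"
  shows "mpow (x + y) \<beta> = (\<Sum>\<alpha> | \<alpha> \<le> \<beta>. of_nat (mbinom \<beta> \<alpha>) * mpow x \<alpha> * mpow y (\<beta> - \<alpha>))"
  unfolding mpow_def mbinom_def atMost_multi_index of_nat_prod vector_add_component
    vector_minus_component binomial_ring prod.distrib[symmetric]
  by (rule prod_sum_vec) simp

section \<open>Integer vectors and integer matrices\<close>

lemma rvec_diff: "rvec (x - y) = rvec x - rvec y"
  and rvec_minus: "rvec (- x) = - rvec x"
  and rvec_add: "rvec (x + y) = rvec x + rvec y"
  by (simp_all add: rvec_def vec_eq_iff)

lemma rvec_0 [simp]: "rvec 0 = 0"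
  by (simp add: rvec_def vec_eq_iff)

lemma rvec_eq_iff: "rvec x = rvec y \<longleftrightarrow> x = y"
  by (simp add: rvec_def vec_eq_iff)

lemma rvec_floor_vec:
  assumes "int_vec x"
  shows "rvec (floor_vec x) = x"
  unfolding vec_eq_iff rvec_def floor_vec_def vec_lambda_beta
  using assms unfolding int_vec_def by (metis Ints_cases floor_of_int)

lemma int_vec_rvec [simp]: "int_vec (rvec k)"
  by (simp add: int_vec_def rvec_def)

lemma rmat_rvec: "rmat M *v rvec k = rvec (M *v k)"
  by (simp add: rmat_def rvec_def matrix_vector_mult_def map_matrix_def vec_eq_iff)

text \<open>A kernel vector would be an eigenvector to the eigenvalue \<open>0\<close>, which is not larger than \<open>1\<close>.\<close>

lemma matrix_dilation_invertible:
  assumes "matrix_dilation M"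
  shows "invertible (rmat M)"
  unfolding invertible_left_inverse matrix_left_invertible_ker
proof (intro allI impI)
  fix x assume x: "rmat M *v x = 0"
  define v where "v = (\<chi> j. complex_of_real (x $ j))"
  have "map_matrix of_int M *v v = (\<chi> i. of_real ((rmat M *v x) $ i))"
    by (simp add: v_def rmat_def map_matrix_def matrix_vector_mult_def)
  also have "\<dots> = 0 *s v" by (simp add: x vec_eq_iff)
  finally have "v = 0"
    using assms unfolding matrix_dilation_def by (metis norm_zero not_one_less_zero)
  then show "x = 0" by (simp add: v_def vec_eq_iff)
qed

lemma Minv_diff: "Minv M (x - y) = Minv M x - Minv M y"
  by (simp add: Minv_def matrix_vector_mult_diff_distrib)

lemma Minv_scaleR: "Minv M (t *\<^sub>R x) = t *\<^sub>R Minv M x"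
  by (simp add: Minv_def matrix_vector_mult_scaleR)

lemma Minv_rmat:
  assumes "invertible (rmat M)"
  shows "Minv M (rmat M *v x) = x" and "rmat M *v Minv M x = x"
proof -
  have "rmat M ** matrix_inv (rmat M) = mat 1 \<and> matrix_inv (rmat M) ** rmat M = mat 1"
    unfolding matrix_inv_def using assms unfolding invertible_def by (rule someI_ex)
  then show "Minv M (rmat M *v x) = x" and "rmat M *v Minv M x = x"
    by (simp_all add: Minv_def matrix_vector_mul_assoc)
qed

lemma int_vec_Minv_iff:
  assumes "invertible (rmat M)"
  shows "int_vec (Minv M (rvec x)) \<longleftrightarrow> x \<in> range (\<lambda>y. M *v y)"
proof
  assume "int_vec (Minv M (rvec x))"
  then have "rvec x = rvec (M *v floor_vec (Minv M (rvec x)))"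
    by (simp add: rmat_rvec[symmetric] rvec_floor_vec Minv_rmat[OF assms])
  then show "x \<in> range (\<lambda>y. M *v y)" unfolding rvec_eq_iff by blast
next
  assume "x \<in> range (\<lambda>y. M *v y)"
  then show "int_vec (Minv M (rvec x))"
    by (auto simp: rmat_rvec[symmetric] Minv_rmat[OF assms])
qed

section \<open>Reflection of the digits\<close>

text \<open>
  The vector \<open>2c - s\<^sub>k\<close> is integral, hence congruent to exactly one digit modulo \<open>M\<close>.
\<close>

lemma partner_exists_unique:
  assumes "invertible (rmat M)" "digit_set M m s" "half_int_vec c"
  shows "\<exists>!l. l < m \<and> int_vec (Minv M (2 *\<^sub>R c - rvec (s k) - rvec (s l)))"
proof -
  have "rvec (floor_vec (2 *\<^sub>R c)) = 2 *\<^sub>R c"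
    using assms(3) by (intro rvec_floor_vec) (simp add: half_int_vec_def int_vec_def)
  then have "int_vec (Minv M (2 *\<^sub>R c - rvec (s k) - rvec (s l)))
      \<longleftrightarrow> (floor_vec (2 *\<^sub>R c) - s k) - s l \<in> range (\<lambda>y. M *v y)" for l
    by (simp add: int_vec_Minv_iff[OF assms(1), symmetric] rvec_diff)
  then show ?thesis using assms(2) by (simp add: digit_set_def)
qed

lemma partner_props:
  assumes "invertible (rmat M)" "digit_set M m s" "half_int_vec c"
  shows partner_less: "partner M m s c k < m"
    and partner_int: "int_vec (Minv M (2 *\<^sub>R c - rvec (s k) - rvec (s (partner M m s c k))))"
    and partner_partner: "k < m \<Longrightarrow> partner M m s c (partner M m s c k) = k"
proof -
  note ex = partner_exists_unique[OF assms]
  show less: "partner M m s c k < m"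
    and int: "int_vec (Minv M (2 *\<^sub>R c - rvec (s k) - rvec (s (partner M m s c k))))"
    using theI'[OF ex[of k]] unfolding partner_def[symmetric] by auto
  show "partner M m s c (partner M m s c k) = k" if "k < m"
    unfolding partner_def[of M m s c "partner M m s c k"]
    by (rule the1_equality[OF ex]) (use that int in \<open>simp add: diff_diff_eq add.commute\<close>)
qed

section \<open>Trigonometric sums with prescribed frequencies\<close>

lemma expw_add: "expw (a + b) \<xi> = expw a \<xi> * expw b \<xi>"
  by (simp add: expw_def inner_add_left distrib_left exp_add[symmetric])

lemma cnj_expw [simp]: "cnj (expw a \<xi>) = expw (- a) \<xi>"
  by (simp add: expw_def exp_cnj)

lemma expw_0 [simp]: "expw 0 \<xi> = 1" and expw_at_0 [simp]: "expw a 0 = 1"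
  by (simp_all add: expw_def)

lemma expw_Mstar: "expw a (Mstar M \<xi>) = expw (rmat M *v a) \<xi>"
  by (simp add: expw_def Mstar_def dot_lmul_matrix[symmetric] transpose_matrix_vector inner_commute)

text \<open>
  The finite sums of exponentials with frequencies in a given set. Generating them one term at a
  time lets every linear property be proved by induction with a single exponential as the step,
  without merging supports of coefficient functions.
\<close>

inductive_set trig_span :: "(real^'d) set \<Rightarrow> (real^'d \<Rightarrow> complex) set" for A where
  zero: "(\<lambda>\<xi>. 0) \<in> trig_span A"
| add_term: "a \<in> A \<Longrightarrow> f \<in> trig_span A \<Longrightarrow> (\<lambda>\<xi>. h * expw a \<xi> + f \<xi>) \<in> trig_span A"

lemma trig_span_add:
  assumes "f \<in> trig_span A" "g \<in> trig_span A"
  shows "(\<lambda>\<xi>. f \<xi> + g \<xi>) \<in> trig_span A"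
  using assms(1)
  by induction (use assms(2) trig_span.add_term in \<open>auto simp: add.assoc\<close>)

lemma trig_span_scale:
  assumes "f \<in> trig_span A"
  shows "(\<lambda>\<xi>. h * f \<xi>) \<in> trig_span A"
  using assms
  by induction (auto simp: distrib_left mult.assoc[symmetric] intro: trig_span.intros)

lemma trig_span_sum:
  assumes "\<And>i. i \<in> F \<Longrightarrow> f i \<in> trig_span A"
  shows "(\<lambda>\<xi>. \<Sum>i\<in>F. f i \<xi>) \<in> trig_span A"
  using assms
  by (induction F rule: infinite_finite_induct) (auto intro: trig_span.zero trig_span_add)

lemma expw_in_trig_span: "a \<in> A \<Longrightarrow> (\<lambda>\<xi>. h * expw a \<xi>) \<in> trig_span A"
  using trig_span.add_term[OF _ trig_span.zero] by fastforce

lemma trig_span_modulate: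
  assumes "f \<in> trig_span A" "\<And>a. a \<in> A \<Longrightarrow> a + b \<in> B"
  shows "(\<lambda>\<xi>. f \<xi> * expw b \<xi>) \<in> trig_span B"
  using assms(1)
proof induction
  case (add_term a f h)
  then show ?case
    using trig_span.add_term[of "a + b" B _ h] assms(2)
    by (simp add: expw_add distrib_right mult.assoc)
qed (simp add: trig_span.zero)

lemma trig_span_cnj:
  assumes "f \<in> trig_span A" "\<And>a. a \<in> A \<Longrightarrow> - a \<in> B"
  shows "(\<lambda>\<xi>. cnj (f \<xi>)) \<in> trig_span B"
  using assms(1)
  by induction (auto intro: trig_span.intros assms(2))

lemma trig_span_Mstar:
  assumes "f \<in> trig_span A" "\<And>a. a \<in> A \<Longrightarrow> rmat M *v a \<in> B"
  shows "(\<lambda>\<xi>. f (Mstar M \<xi>)) \<in> trig_span B"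
  using assms(1)
  by induction (auto simp: expw_Mstar intro: trig_span.intros assms(2))

text \<open>
  For frequencies in a translate of the integer lattice the terms can be collected into a single
  coefficient function on the lattice, the form in which semi-integer degrees are defined.
\<close>

lemma trig_span_integer_shift_coeffs:
  fixes \<sigma> :: "real^'d"
  assumes "f \<in> trig_span (range (\<lambda>k. rvec k + \<sigma>))"
  shows "\<exists>h. finite {k. h k \<noteq> 0} \<and> (\<forall>\<xi>. f \<xi> = (\<Sum>k | h k \<noteq> 0. h k * expw (rvec k + \<sigma>) \<xi>))"
  using assms
proof induction
  case zero
  show ?case by (intro exI[of _ "\<lambda>k. 0"]) auto
next
  case (add_term a f c)
  then obtain l h where a: "a = rvec l + \<sigma>" and fin: "finite {k. h k \<noteq> 0}"
    and f: "\<And>\<xi>. f \<xi> = (\<Sum>k | h k \<noteq> 0. h k * expw (rvec k + \<sigma>) \<xi>)" by auto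
  define h' where "h' = h(l := h l + c)"
  define K where "K = insert l {k. h k \<noteq> 0}"
  have K: "finite K" "{k. h k \<noteq> 0} \<subseteq> K" "{k. h' k \<noteq> 0} \<subseteq> K"
    using fin by (auto simp: K_def h'_def)
  \<comment> \<open>The new term may create or cancel the coefficient at \<open>l\<close>, so all sums are compared on \<open>K\<close>.\<close>
  have "c * expw a \<xi> + f \<xi> = (\<Sum>k | h' k \<noteq> 0. h' k * expw (rvec k + \<sigma>) \<xi>)" for \<xi>
  proof -
    have "f \<xi> = (\<Sum>k\<in>K. h k * expw (rvec k + \<sigma>) \<xi>)"
      unfolding f using K by (intro sum.mono_neutral_left) auto
    moreover have "c * expw a \<xi> = (\<Sum>k\<in>K. (if k = l then c else 0) * expw (rvec k + \<sigma>) \<xi>)"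
      using K(1) by (simp add: a if_distrib[of "\<lambda>x. x * _"] K_def cong: if_cong)
    moreover have "(\<Sum>k | h' k \<noteq> 0. h' k * expw (rvec k + \<sigma>) \<xi>)
        = (\<Sum>k\<in>K. h' k * expw (rvec k + \<sigma>) \<xi>)"
      using K by (intro sum.mono_neutral_left) auto
    ultimately show ?thesis
      by (auto simp: h'_def sum.distrib[symmetric] distrib_right intro!: sum.cong)
  qed
  with finite_subset[OF K(3,1)] show ?case by blast
qed

lemma semi_trig_poly_trig_span:
  assumes "f \<in> trig_span (range (\<lambda>k. rvec k + \<sigma>))"
    and "half_int_vec \<sigma>" "\<And>j. 0 \<le> \<sigma> $ j" "\<And>j. \<sigma> $ j \<le> 1/2"
  shows "semi_trig_poly \<sigma> f"
  using trig_span_integer_shift_coeffs[OF assms(1)] assms(2-4) by (auto simp: semi_trig_poly_def)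

lemma trig_poly_trig_span:
  assumes "f \<in> trig_span (range rvec)"
  shows "trig_poly f"
  unfolding trig_poly_def
  by (rule semi_trig_poly_trig_span) (use assms in \<open>auto simp: half_int_vec_def\<close>)

section \<open>Moments\<close>

text \<open>
  For \<open>f(\<xi>) = \<Sum> h\<^sub>a e\<^bsup>2\<pi>i(a,\<xi>)\<^esup>\<close> this is the power moment \<open>\<Sum> h\<^sub>a a\<^sup>\<alpha>\<close> of the coefficients, which is what
  makes the normalisation natural.
\<close>

definition moment :: "(real^'d \<Rightarrow> complex) \<Rightarrow> nat^'d \<Rightarrow> complex" where
  "moment f \<alpha> = mderiv \<alpha> f 0 / (2 * of_real pi * \<i>) ^ mdeg \<alpha>"

lemma mderiv_moment: "mderiv \<alpha> f 0 = (2 * of_real pi * \<i>) ^ mdeg \<alpha> * moment f \<alpha>"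
  by (simp add: moment_def)

lemma moment_0: "moment f 0 = f 0"
proof -
  have "fold (\<lambda>j. partial j ^^ ((0::nat^'a) $ j)) js f = f" for js
    by (induction js) auto
  then show ?thesis by (simp add: moment_def mderiv_def mdeg_def)
qed

lemma expw_has_vector_derivative:
  "((\<lambda>t. expw a (x + t *\<^sub>R axis j 1)) has_vector_derivative
     2 * of_real pi * \<i> * of_real (a $ j) * expw a x) (at 0)"
proof -
  define B :: complex where "B = 2 * of_real pi * \<i> * of_real (a $ j)"
  define C :: complex where "C = 2 * of_real pi * \<i> * of_real (a \<bullet> x)"
  have "((\<lambda>z. exp (C + z * B)) has_field_derivative B * exp C) (at (of_real 0))"
    by (auto intro!: derivative_eq_intros)
  from has_vector_derivative_real_field[OF this]
  have "((\<lambda>t. exp (C + of_real t * B)) has_vector_derivative B * exp C) (at 0)"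
    by simp
  then show ?thesis
    by (simp add: expw_def inner_add_right inner_axis B_def C_def algebra_simps)
qed

lemma trig_span_differentiable:
  assumes "f \<in> trig_span A"
  shows "(\<lambda>t. f (x + t *\<^sub>R axis j 1)) differentiable (at 0)"
  using assms
proof induction
  case (add_term a f h)
  have "(\<lambda>t. expw a (x + t *\<^sub>R axis j 1)) differentiable (at 0)"
    using expw_has_vector_derivative differentiableI_vector by blast
  with add_term show ?case by (intro differentiable_add differentiable_mult) auto
qed simp

lemma partial_add_term:
  assumes "f \<in> trig_span A"
  shows "partial j (\<lambda>\<xi>. h * expw a \<xi> + f \<xi>)
    = (\<lambda>\<xi>. h * (2 * of_real pi * \<i> * of_real (a $ j)) * expw a \<xi> + partial j f \<xi>)"
proof
  fix x
  have "((\<lambda>t. f (x + t *\<^sub>R axis j 1)) has_vector_derivative partial j f x) (at 0)"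
    unfolding partial_def
    using trig_span_differentiable[OF assms] by (simp add: vector_derivative_works)
  from has_vector_derivative_add[OF has_vector_derivative_mult_right[OF expw_has_vector_derivative] this]
  show "partial j (\<lambda>\<xi>. h * expw a \<xi> + f \<xi>) x
    = h * (2 * of_real pi * \<i> * of_real (a $ j)) * expw a x + partial j f x"
    unfolding partial_def[of j "\<lambda>\<xi>. h * expw a \<xi> + f \<xi>"]
    by (intro vector_derivative_at) (simp add: mult.assoc)
qed

lemma trig_span_partial: "f \<in> trig_span A \<Longrightarrow> partial j f \<in> trig_span A"
proof (induction rule: trig_span.induct)
  case zero
  then show ?case by (simp add: partial_def trig_span.zero)
qed (simp add: partial_add_term trig_span.add_term)

lemma trig_span_partial_power: "f \<in> trig_span A \<Longrightarrow> (partial j ^^ n) f \<in> trig_span A"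
  by (induction n) (auto intro: trig_span_partial)

lemma partial_power_add_term:
  assumes "f \<in> trig_span A"
  shows "(partial j ^^ n) (\<lambda>\<xi>. h * expw a \<xi> + f \<xi>)
    = (\<lambda>\<xi>. h * (2 * of_real pi * \<i> * of_real (a $ j)) ^ n * expw a \<xi> + (partial j ^^ n) f \<xi>)"
proof (induction n)
  case (Suc n)
  have "(partial j ^^ Suc n) (\<lambda>\<xi>. h * expw a \<xi> + f \<xi>) = partial j
      (\<lambda>\<xi>. h * (2 * of_real pi * \<i> * of_real (a $ j)) ^ n * expw a \<xi> + (partial j ^^ n) f \<xi>)"
    by (simp only: Suc.IH funpow.simps comp_apply)
  also have "\<dots> = (\<lambda>\<xi>. h * (2 * of_real pi * \<i> * of_real (a $ j)) ^ Suc n * expw a \<xi>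
      + (partial j ^^ Suc n) f \<xi>)"
    unfolding partial_add_term[OF trig_span_partial_power[OF assms]] by (simp add: mult_ac)
  finally show ?case .
qed simp

lemma fold_partial_add_term:
  assumes "f \<in> trig_span A"
  shows "fold (\<lambda>j. partial j ^^ (\<alpha> $ j)) js (\<lambda>\<xi>. h * expw a \<xi> + f \<xi>)
    = (\<lambda>\<xi>. h * (\<Prod>j\<leftarrow>js. (2 * of_real pi * \<i> * of_real (a $ j)) ^ (\<alpha> $ j)) * expw a \<xi>
        + fold (\<lambda>j. partial j ^^ (\<alpha> $ j)) js f \<xi>)"
  using assms
proof (induction js arbitrary: h f)
  case (Cons j js)
  let ?c = "\<lambda>j. (2 * of_real pi * \<i> * of_real (a $ j)) ^ (\<alpha> $ j)"
  let ?g = "(partial j ^^ (\<alpha> $ j)) f"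
  let ?D = "fold (\<lambda>j. partial j ^^ (\<alpha> $ j)) js"
  have "fold (\<lambda>j. partial j ^^ (\<alpha> $ j)) (j # js) (\<lambda>\<xi>. h * expw a \<xi> + f \<xi>)
      = ?D (\<lambda>\<xi>. h * ?c j * expw a \<xi> + ?g \<xi>)"
    by (simp only: fold_Cons comp_apply partial_power_add_term[OF Cons.prems])
  also have "\<dots> = (\<lambda>\<xi>. h * ?c j * (\<Prod>j\<leftarrow>js. ?c j) * expw a \<xi> + ?D ?g \<xi>)"
    by (rule Cons.IH[OF trig_span_partial_power[OF Cons.prems]])
  finally show ?case by (simp only: fold_Cons comp_apply list.map prod_list.Cons mult.assoc)
qed simp

text \<open>
  An exponential is an eigenfunction of every partial derivative, so the order in which the
  coordinates are processed does not influence the product of the eigenvalues.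
\<close>

lemma moment_add_term:
  fixes a :: "real^'d"
  assumes "f \<in> trig_span A"
  shows "moment (\<lambda>\<xi>. h * expw a \<xi> + f \<xi>) \<alpha> = h * of_real (mpow a \<alpha>) + moment f \<alpha>"
proof -
  define js where "js = (SOME js. set js = (UNIV :: 'd set) \<and> distinct js)"
  have js: "set js = UNIV \<and> distinct js"
    unfolding js_def by (rule someI_ex) (use finite_distinct_list[of "UNIV :: 'd set"] in auto)
  then have conv: "(\<Prod>j\<in>UNIV. g j) = (\<Prod>j\<leftarrow>js. g j)" for g :: "'d \<Rightarrow> complex"
    using prod.distinct_set_conv_list[of js g] by simp
  have "(\<Prod>j\<leftarrow>js. (2 * of_real pi * \<i> * of_real (a $ j)) ^ (\<alpha> $ j))
      = (\<Prod>j\<in>UNIV. (2 * of_real pi * \<i> * of_real (a $ j)) ^ (\<alpha> $ j))"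
    by (rule conv[symmetric])
  also have "\<dots> = (2 * of_real pi * \<i>) ^ mdeg \<alpha> * of_real (mpow a \<alpha>)"
    by (simp add: mpow_def mdeg_def power_mult_distrib prod.distrib power_sum)
  finally show ?thesis
    unfolding moment_def mderiv_def js_def[symmetric] fold_partial_add_term[OF assms]
    by (simp add: add_divide_distrib)
qed

lemma moment_zero [simp]: "moment (\<lambda>\<xi>. 0) \<alpha> = 0"
proof -
  have "partial j (\<lambda>\<xi>. 0) = (\<lambda>\<xi>. 0)" for j :: 'a
    by (simp add: partial_def)
  then have "(partial j ^^ k) (\<lambda>\<xi>. 0) = (\<lambda>\<xi>. 0)" for j :: 'a and k
    by (induction k) simp_all
  then have "fold (\<lambda>j. partial j ^^ (\<alpha> $ j)) js (\<lambda>\<xi>. 0) = (\<lambda>\<xi>. 0)" for js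
    by (induction js) simp_all
  then show ?thesis by (simp add: moment_def mderiv_def)
qed

lemma moment_expw: "moment (\<lambda>\<xi>. h * expw a \<xi>) \<alpha> = h * of_real (mpow a \<alpha>)"
  using moment_add_term[OF trig_span.zero, of h a \<alpha>] by simp

lemma moment_add:
  assumes "f \<in> trig_span A" "g \<in> trig_span A"
  shows "moment (\<lambda>\<xi>. f \<xi> + g \<xi>) \<alpha> = moment f \<alpha> + moment g \<alpha>"
  using assms(1)
proof induction
  case (add_term a f h)
  have "moment (\<lambda>\<xi>. h * expw a \<xi> + f \<xi> + g \<xi>) \<alpha> = moment (\<lambda>\<xi>. h * expw a \<xi> + (f \<xi> + g \<xi>)) \<alpha>"
    by (simp only: add.assoc)
  also have "\<dots> = h * of_real (mpow a \<alpha>) + moment (\<lambda>\<xi>. f \<xi> + g \<xi>) \<alpha>"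
    by (rule moment_add_term[OF trig_span_add[OF add_term.hyps(2) assms(2)]])
  also have "\<dots> = moment (\<lambda>\<xi>. h * expw a \<xi> + f \<xi>) \<alpha> + moment g \<alpha>"
    unfolding add_term.IH moment_add_term[OF add_term.hyps(2)] by (simp only: add.assoc)
  finally show ?case .
qed simp

lemma moment_scale:
  assumes "f \<in> trig_span A"
  shows "moment (\<lambda>\<xi>. h * f \<xi>) \<alpha> = h * moment f \<alpha>"
  using assms
proof induction
  case (add_term a f k)
  have "moment (\<lambda>\<xi>. h * (k * expw a \<xi> + f \<xi>)) \<alpha> = moment (\<lambda>\<xi>. h * k * expw a \<xi> + h * f \<xi>) \<alpha>"
    by (simp only: distrib_left mult.assoc)
  also have "\<dots> = h * k * of_real (mpow a \<alpha>) + moment (\<lambda>\<xi>. h * f \<xi>) \<alpha>"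
    by (rule moment_add_term[OF trig_span_scale[OF add_term.hyps(2)]])
  also have "\<dots> = h * moment (\<lambda>\<xi>. k * expw a \<xi> + f \<xi>) \<alpha>"
    unfolding add_term.IH moment_add_term[OF add_term.hyps(2)] by (simp only: distrib_left mult.assoc)
  finally show ?case .
qed simp

lemma moment_sum:
  assumes "\<And>i. i \<in> F \<Longrightarrow> f i \<in> trig_span A"
  shows "moment (\<lambda>\<xi>. \<Sum>i\<in>F. f i \<xi>) \<alpha> = (\<Sum>i\<in>F. moment (f i) \<alpha>)"
  using assms
proof (induction F rule: infinite_finite_induct)
  case (insert i F)
  then have "moment (\<lambda>\<xi>. f i \<xi> + (\<Sum>i\<in>F. f i \<xi>)) \<alpha> = moment (f i) \<alpha> + moment (\<lambda>\<xi>. \<Sum>i\<in>F. f i \<xi>) \<alpha>"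
    by (intro moment_add[OF _ trig_span_sum]) auto
  with insert show ?case by simp
qed simp_all

lemma moment_cnj:
  assumes "f \<in> trig_span A"
  shows "moment (\<lambda>\<xi>. cnj (f \<xi>)) \<alpha> = (-1) ^ mdeg \<alpha> * cnj (moment f \<alpha>)"
  using assms
proof induction
  case (add_term a f h)
  then show ?case
    by (simp add: moment_add_term[OF add_term.hyps(2)]
        moment_add_term[OF trig_span_cnj[OF add_term.hyps(2) UNIV_I]] mpow_minus distrib_left)
qed simp

text \<open>
  If \<open>l \<alpha>\<close> are the moments of a finitely supported complex measure, these are the moments of its translate by \<open>x\<close>.
\<close>

definition binom_shift :: "(nat^'d \<Rightarrow> complex) \<Rightarrow> real^'d \<Rightarrow> nat^'d \<Rightarrow> complex" where
  "binom_shift l x \<beta> =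
     (\<Sum>\<gamma> | \<gamma> \<le> \<beta>. l \<gamma> * of_nat (mbinom \<beta> \<gamma>) * of_real (mpow x (\<beta> - \<gamma>)))"

text \<open>
  This is the Leibniz rule for multiplication by an exponential; on a single exponential it is
  the binomial theorem for \<open>(a + b)\<^sup>\<beta>\<close>, and both sides are linear.
\<close>

lemma moment_modulate:
  assumes "f \<in> trig_span A"
  shows "moment (\<lambda>\<xi>. f \<xi> * expw b \<xi>) \<beta> = binom_shift (moment f) b \<beta>"
  using assms
proof induction
  case (add_term a f h)
  have "moment (\<lambda>\<xi>. (h * expw a \<xi> + f \<xi>) * expw b \<xi>) \<beta>
      = moment (\<lambda>\<xi>. h * expw (a + b) \<xi> + f \<xi> * expw b \<xi>) \<beta>"
    by (simp add: expw_add distrib_right mult.assoc)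
  also have "\<dots> = h * of_real (mpow (a + b) \<beta>) + binom_shift (moment f) b \<beta>"
    using add_term by (simp add: moment_add_term[OF trig_span_modulate[OF _ UNIV_I]])
  also have "\<dots> = binom_shift (moment (\<lambda>\<xi>. h * expw a \<xi> + f \<xi>)) b \<beta>"
    unfolding binom_shift_def moment_add_term[OF add_term.hyps(2)]
    by (simp add: mpow_add sum_distrib_left sum.distrib algebra_simps)
  finally show ?case .
qed (simp add: binom_shift_def)

lemma binom_shift_cong:
  assumes "\<And>\<gamma>. \<gamma> \<le> \<beta> \<Longrightarrow> l \<gamma> = l' \<gamma>"
  shows "binom_shift l x \<beta> = binom_shift l' x \<beta>"
  unfolding binom_shift_def by (rule sum.cong) (use assms in auto)

lemma cnj_binom_shift: "cnj (binom_shift l x \<beta>) = binom_shift (\<lambda>\<alpha>. cnj (l \<alpha>)) x \<beta>"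
  by (simp add: binom_shift_def)

lemma binom_shift_minus:
  "(-1) ^ mdeg \<beta> * binom_shift l x \<beta> = binom_shift (\<lambda>\<alpha>. (-1) ^ mdeg \<alpha> * l \<alpha>) (- x) \<beta>"
  unfolding binom_shift_def sum_distrib_left
proof (rule sum.cong)
  fix \<gamma> assume "\<gamma> \<in> {\<gamma>. \<gamma> \<le> \<beta>}"
  then have "mdeg \<beta> = mdeg \<gamma> + mdeg (\<beta> - \<gamma>)" by (simp add: mdeg_add_diff)
  then show "(-1) ^ mdeg \<beta> * (l \<gamma> * of_nat (mbinom \<beta> \<gamma>) * of_real (mpow x (\<beta> - \<gamma>)))
     = (-1) ^ mdeg \<gamma> * l \<gamma> * of_nat (mbinom \<beta> \<gamma>) * of_real (mpow (- x) (\<beta> - \<gamma>))"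
    by (simp add: mpow_minus power_add mult_ac)
qed simp

section \<open>Trigonometric polynomials with a single nonzero moment\<close>

text \<open>
  The weights are the coefficients of \<open>X\<^sup>b\<close> in the Lagrange basis polynomials for the nodes
  \<open>k + \<sigma>\<close>, \<open>0 \<le> k < n\<close>: interpolation reproduces \<open>X\<^sup>a\<close> for \<open>a < n\<close>, and the claim compares the
  coefficients of \<open>X\<^sup>b\<close>.
\<close>

lemma dual_to_powers:
  fixes \<sigma> :: complex
  shows "\<exists>h :: int \<Rightarrow> complex. \<forall>a<n. (\<Sum>k\<in>{0..<int n}. h k * (of_int k + \<sigma>) ^ a) = (if a = b then 1 else 0)"
proof -
  define x :: "int \<Rightarrow> complex" where "x k = of_int k + \<sigma>" for k
  define K where "K = {0..<int n}"
  have fin: "finite K" and card: "card K = n" by (auto simp: K_def)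
  have inj: "inj_on x K" by (auto simp: x_def inj_on_def)
  define L :: "int \<Rightarrow> complex poly"
    where "L k = (\<Prod>i\<in>K - {k}. smult (inverse (x k - x i)) [:- x i, 1:])" for k
  have eval: "poly (L k) y = (\<Prod>i\<in>K - {k}. inverse (x k - x i) * (y - x i))" for k y
    by (simp add: L_def poly_prod algebra_simps)
  have poly_L: "poly (L k) (x l) = (if l = k then 1 else 0)" if "k \<in> K" "l \<in> K" for k l
  proof (cases "l = k")
    case True
    have "(\<Prod>i\<in>K - {k}. inverse (x k - x i) * (x k - x i)) = 1"
      using inj \<open>k \<in> K\<close> by (intro prod.neutral ballI left_inverse) (auto simp: inj_on_def)
    then show ?thesis using True by (simp only: eval if_True refl)
  next
    case False
    then have "(\<Prod>i\<in>K - {k}. inverse (x k - x i) * (x l - x i)) = 0"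
      using fin that by (intro prod_zero) auto
    then show ?thesis using False by (simp only: eval if_False)
  qed
  have degree_L: "degree (L k) < n" if "k \<in> K" for k
  proof -
    have "degree (L k) \<le> (\<Sum>i\<in>K - {k}. degree (smult (inverse (x k - x i)) [:- x i, 1:]))"
      unfolding L_def using degree_prod_sum_le fin by (metis (no_types, lifting) comp_apply finite_Diff sum.cong)
    also have "\<dots> \<le> (\<Sum>i\<in>K - {k}. 1)" by (intro sum_mono) (simp add: degree_smult_le)
    also have "\<dots> < n" using that fin card card_gt_0_iff[of K] by auto
    finally show ?thesis .
  qed
  have "(\<Sum>k\<in>K. coeff (L k) b * x k ^ a) = (if a = b then 1 else 0)" if "a < n" for a
  proof -
    define q where "q = (\<Sum>k\<in>K. smult (x k ^ a) (L k))"
    have "monom 1 a = q"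
    proof (rule poly_eqI_degree[of "x ` K"])
      fix y assume "y \<in> x ` K"
      then obtain l where l: "y = x l" "l \<in> K" by auto
      have "poly q y = (\<Sum>k\<in>K. x k ^ a * (if l = k then 1 else 0))"
        unfolding q_def poly_sum using l poly_L by (intro sum.cong) auto
      also have "\<dots> = x l ^ a" using fin l by (simp add: if_distrib cong: if_cong)
      finally show "poly (monom 1 a) y = poly q y" by (simp add: l poly_monom)
    next
      show "degree (monom (1::complex) a) < card (x ` K)"
        using that by (simp add: card_image[OF inj] card degree_monom_eq)
      show "degree q < card (x ` K)"
        unfolding q_def card_image[OF inj] card using that degree_L
        by (intro degree_sum_less) (auto intro: le_less_trans[OF degree_smult_le])
    qed
    from arg_cong[OF this, of "\<lambda>p. coeff p b"] show ?thesis
      by (simp add: q_def coeff_sum mult.commute)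
  qed
  then show ?thesis by (intro exI[of _ "\<lambda>k. coeff (L k) b"]) (auto simp: x_def K_def)
qed

text \<open>
  Products of one-dimensional weights have products of one-dimensional moments. The weights in
  coordinate \<open>j\<close> control powers below \<open>n\<close>, and every entry of a multi-index in \<open>\<Delta>\<^sub>n\<close> is below \<open>n\<close>.
\<close>

lemma exists_dual_to_moments:
  fixes \<sigma> :: "real^'d"
  shows "\<exists>t\<in>trig_span (range (\<lambda>k. rvec k + \<sigma>)).
    \<forall>\<alpha>\<in>Delta n. moment t \<alpha> = (if \<alpha> = \<beta> then 1 else 0)"
proof -
  have "\<exists>h :: int \<Rightarrow> complex. \<forall>a<n. (\<Sum>k\<in>{0..<int n}. h k * (of_int k + of_real (\<sigma> $ j)) ^ a)
      = (if a = \<beta> $ j then 1 else 0)" for j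
    by (rule dual_to_powers)
  then obtain h :: "'d \<Rightarrow> int \<Rightarrow> complex" where h:
    "\<And>j a. a < n \<Longrightarrow> (\<Sum>k\<in>{0..<int n}. h j k * (of_int k + of_real (\<sigma> $ j)) ^ a)
      = (if a = \<beta> $ j then 1 else 0)"
    by metis
  define K where "K = {k :: int^'d. \<forall>j. k $ j \<in> {0..<int n}}"
  define t where "t = (\<lambda>\<xi>. \<Sum>k\<in>K. (\<Prod>j\<in>UNIV. h j (k $ j)) * expw (rvec k + \<sigma>) \<xi>)"
  have "t \<in> trig_span (range (\<lambda>k. rvec k + \<sigma>))"
    unfolding t_def by (intro trig_span_sum expw_in_trig_span) auto
  moreover have "moment t \<alpha> = (if \<alpha> = \<beta> then 1 else 0)" if "\<alpha> \<in> Delta n" for \<alpha>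
  proof -
    have "\<alpha> $ j < n" for j
      using that nth_le_mdeg[of \<alpha> j] by (simp add: Delta_def)
    then have "(\<Prod>j\<in>UNIV. \<Sum>k\<in>{0..<int n}. h j k * (of_int k + of_real (\<sigma> $ j)) ^ (\<alpha> $ j))
        = (\<Prod>j\<in>UNIV. if \<alpha> $ j = \<beta> $ j then 1 else 0)"
      by (simp add: h)
    also have "\<dots> = (if \<alpha> = \<beta> then 1 else 0)"
      by (auto simp: vec_eq_iff)
    finally have "(\<Prod>j\<in>UNIV. \<Sum>k\<in>{0..<int n}. h j k * (of_int k + of_real (\<sigma> $ j)) ^ (\<alpha> $ j))
        = (if \<alpha> = \<beta> then 1 else 0)" .
    moreover have "moment t \<alpha> = (\<Sum>k\<in>K. (\<Prod>j\<in>UNIV. h j (k $ j)) * of_real (mpow (rvec k + \<sigma>) \<alpha>))"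
      unfolding t_def by (subst moment_sum[where A = UNIV]) (auto simp: moment_expw intro: expw_in_trig_span)
    moreover have "\<dots> = (\<Prod>j\<in>UNIV. \<Sum>k\<in>{0..<int n}. h j k * (of_int k + of_real (\<sigma> $ j)) ^ (\<alpha> $ j))"
      unfolding K_def by (subst prod_sum_vec) (simp_all add: mpow_def rvec_def prod.distrib)
    ultimately show ?thesis by simp
  qed
  ultimately show ?thesis by blast
qed

text \<open>
  Half of \<open>t + (-1)\<^bsup>[\<beta>]\<^esup> cnj t\<close> is symmetric. Its moments are unchanged because a moment of order \<open>\<beta>\<close>
  picks up the sign \<open>(-1)\<^bsup>[\<beta>]\<^esup>\<close> twice and the others in question are \<open>0\<close>; its frequencies stay in the same
  translate of the lattice because \<open>2\<sigma>\<close> is integral.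
\<close>

lemma exists_symmetric_dual_to_moments:
  fixes \<sigma> :: "real^'d"
  assumes "half_int_vec \<sigma>"
  shows "\<exists>t\<in>trig_span (range (\<lambda>k. rvec k + \<sigma>)).
    (\<forall>\<alpha>\<in>Delta n. moment t \<alpha> = (if \<alpha> = \<beta> then 1 else 0)) \<and> (\<forall>\<xi>. t \<xi> = (-1) ^ mdeg \<beta> * cnj (t \<xi>))"
proof -
  obtain t where t: "t \<in> trig_span (range (\<lambda>k. rvec k + \<sigma>))"
    and mom: "\<And>\<alpha>. \<alpha> \<in> Delta n \<Longrightarrow> moment t \<alpha> = (if \<alpha> = \<beta> then 1 else 0)"
    using exists_dual_to_moments[of \<sigma>] by meson
  define u where "u = (\<lambda>\<xi>. 1/2 * t \<xi> + (-1) ^ mdeg \<beta> / 2 * cnj (t \<xi>))"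
  have "- (rvec k + \<sigma>) \<in> range (\<lambda>k. rvec k + \<sigma>)" for k
  proof (rule image_eqI)
    have "rvec (floor_vec (2 *\<^sub>R \<sigma>)) = 2 *\<^sub>R \<sigma>"
      using assms by (intro rvec_floor_vec) (simp add: half_int_vec_def int_vec_def)
    then show "- (rvec k + \<sigma>) = rvec (- k - floor_vec (2 *\<^sub>R \<sigma>)) + \<sigma>"
      by (simp add: rvec_diff rvec_minus scaleR_2)
  qed simp
  then have cnj_t: "(\<lambda>\<xi>. cnj (t \<xi>)) \<in> trig_span (range (\<lambda>k. rvec k + \<sigma>))"
    using t by (intro trig_span_cnj) auto
  have "u \<in> trig_span (range (\<lambda>k. rvec k + \<sigma>))"
    unfolding u_def by (intro trig_span_add trig_span_scale t cnj_t)
  moreover have "moment u \<alpha> = (if \<alpha> = \<beta> then 1 else 0)" if "\<alpha> \<in> Delta n" for \<alpha>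
    unfolding u_def
      moment_add[OF trig_span_scale[OF t] trig_span_scale[OF cnj_t]] moment_scale[OF t]
      moment_scale[OF cnj_t] moment_cnj[OF t] mom[OF that]
    by (auto simp: power_add[symmetric] mult_2[symmetric])
  moreover have "u \<xi> = (-1) ^ mdeg \<beta> * cnj (u \<xi>)" for \<xi>
    by (simp add: u_def algebra_simps power_add[symmetric] mult_2[symmetric])
  ultimately show ?thesis by blast
qed

lemma dual_combination:
  assumes "\<And>\<beta>. \<beta> \<in> Delta n \<Longrightarrow> G \<beta> \<in> trig_span A"
    and "\<And>\<beta> \<alpha>. \<beta> \<in> Delta n \<Longrightarrow> \<alpha> \<in> Delta n \<Longrightarrow> moment (G \<beta>) \<alpha> = (if \<alpha> = \<beta> then 1 else 0)"
  shows "(\<lambda>\<xi>. \<Sum>\<beta>\<in>Delta n. l \<beta> * G \<beta> \<xi>) \<in> trig_span A"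
    and "\<alpha> \<in> Delta n \<Longrightarrow> moment (\<lambda>\<xi>. \<Sum>\<beta>\<in>Delta n. l \<beta> * G \<beta> \<xi>) \<alpha> = l \<alpha>"
proof -
  show "(\<lambda>\<xi>. \<Sum>\<beta>\<in>Delta n. l \<beta> * G \<beta> \<xi>) \<in> trig_span A"
    by (intro trig_span_sum trig_span_scale assms(1))
  assume \<alpha>: "\<alpha> \<in> Delta n"
  have "moment (\<lambda>\<xi>. \<Sum>\<beta>\<in>Delta n. l \<beta> * G \<beta> \<xi>) \<alpha> = (\<Sum>\<beta>\<in>Delta n. moment (\<lambda>\<xi>. l \<beta> * G \<beta> \<xi>) \<alpha>)"
    by (rule moment_sum[where A = A]) (intro trig_span_scale assms(1))
  also have "\<dots> = (\<Sum>\<beta>\<in>Delta n. if \<alpha> = \<beta> then l \<beta> else 0)"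
    by (intro sum.cong) (auto simp: moment_scale[OF assms(1)] assms(2) \<alpha>)
  finally show "moment (\<lambda>\<xi>. \<Sum>\<beta>\<in>Delta n. l \<beta> * G \<beta> \<xi>) \<alpha> = l \<alpha>"
    using \<alpha> by simp
qed

lemma exists_trig_span_moments:
  fixes l :: "nat^'d \<Rightarrow> complex"
  shows "\<exists>t\<in>trig_span UNIV. \<forall>\<alpha>\<in>Delta n. moment t \<alpha> = l \<alpha>"
proof -
  have "\<exists>t\<in>trig_span UNIV. \<forall>\<alpha>\<in>Delta n. moment t \<alpha> = (if \<alpha> = \<beta> then 1 else 0)" for \<beta> :: "nat^'d"
  proof -
    obtain t where t: "t \<in> trig_span (range (\<lambda>k. rvec k + 0))"
      "\<forall>\<alpha>\<in>Delta n. moment t \<alpha> = (if \<alpha> = \<beta> then 1 else 0)"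
      using exists_dual_to_moments by blast
    from trig_span_modulate[OF t(1) UNIV_I, of 0] have "t \<in> trig_span UNIV" by simp
    with t(2) show ?thesis by blast
  qed
  then obtain G where "\<And>\<beta> :: nat^'d. G \<beta> \<in> trig_span UNIV"
    "\<And>\<beta> \<alpha>. \<alpha> \<in> Delta n \<Longrightarrow> moment (G \<beta>) \<alpha> = (if \<alpha> = \<beta> then 1 else 0)" by metis
  from dual_combination[where l = l, OF this] show ?thesis by auto
qed

text \<open>
  Instead of manipulating a double sum of binomial coefficients, realise the relevant values of
  \<open>l\<close> as moments of a trigonometric sum; then both sides are the moment of order \<open>\<beta>\<close> of that sum
  multiplied by \<open>e\<^bsup>2\<pi>i(x+y,\<xi>)\<^esup>\<close>.
\<close>

lemma binom_shift_add: "binom_shift (binom_shift l x) y \<beta> = binom_shift l (x + y) \<beta>"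
proof -
  obtain t where t: "t \<in> trig_span UNIV"
    and mom: "\<And>\<alpha>. \<alpha> \<in> Delta (Suc (mdeg \<beta>)) \<Longrightarrow> moment t \<alpha> = l \<alpha>"
    using exists_trig_span_moments by blast
  have le: "\<alpha> \<in> Delta (Suc (mdeg \<beta>))" if "\<alpha> \<le> \<beta>" for \<alpha>
    using Delta_downward[OF that] by (simp add: Delta_def)
  have shift: "moment (\<lambda>\<xi>. t \<xi> * expw z \<xi>) \<alpha> = binom_shift l z \<alpha>" if "\<alpha> \<le> \<beta>" for \<alpha> z
    unfolding moment_modulate[OF t]
    using that by (intro binom_shift_cong mom le) (rule order_trans)
  have "binom_shift (binom_shift l x) y \<beta> = binom_shift (moment (\<lambda>\<xi>. t \<xi> * expw x \<xi>)) y \<beta>"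
    by (rule binom_shift_cong) (simp add: shift)
  also have "\<dots> = moment (\<lambda>\<xi>. t \<xi> * expw x \<xi> * expw y \<xi>) \<beta>"
    by (simp add: moment_modulate[OF trig_span_modulate[OF t UNIV_I]])
  also have "\<dots> = binom_shift l (x + y) \<beta>"
    using shift[of \<beta> "x + y"] by (simp add: expw_add mult.assoc)
  finally show ?thesis .
qed

section \<open>The symmetric mask\<close>

text \<open>
  Twice the fractional part of a half-integer is an integer in \<open>[0,2)\<close>, hence at most \<open>1\<close>.
\<close>

lemma frac_half_int_vec:
  assumes "half_int_vec x"
  shows "half_int_vec (x - rvec (floor_vec x))"
    and "0 \<le> (x - rvec (floor_vec x)) $ j" and "(x - rvec (floor_vec x)) $ j \<le> 1/2"
proof -
  have nth: "(x - rvec (floor_vec x)) $ i = x $ i - of_int \<lfloor>x $ i\<rfloor>" for i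
    by (simp add: rvec_def floor_vec_def)
  show "half_int_vec (x - rvec (floor_vec x))"
    using assms unfolding half_int_vec_def nth right_diff_distrib
    by (metis Ints_diff Ints_mult Ints_numeral Ints_of_int)
  show "0 \<le> (x - rvec (floor_vec x)) $ j" unfolding nth by linarith
  obtain k where k: "2 * x $ j = of_int k"
    using assms unfolding half_int_vec_def by (metis Ints_cases)
  have "2 * of_int \<lfloor>x $ j\<rfloor> \<le> 2 * x $ j" "2 * x $ j < 2 * of_int \<lfloor>x $ j\<rfloor> + (2::real)"
    by linarith+
  then have "k \<le> 2 * \<lfloor>x $ j\<rfloor> + 1" unfolding k by linarith
  then have "2 * x $ j \<le> 2 * of_int \<lfloor>x $ j\<rfloor> + (1::real)" unfolding k by linarith
  then show "(x - rvec (floor_vec x)) $ j \<le> 1/2" unfolding nth by linarith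
qed

lemma Theta_iff_moment:
  "t \<in> Theta \<beta> n \<longleftrightarrow> (\<exists>\<sigma>. semi_trig_poly \<sigma> t)
     \<and> (\<forall>\<alpha>\<in>Delta n. moment t \<alpha> = (if \<alpha> = \<beta> then 1 else 0))"
  by (simp add: Theta_def mderiv_moment)

theorem theorem10:
  fixes M :: "int^'d^'d" and m n :: nat and c :: "real^'d"
    and s :: "nat \<Rightarrow> int^'d" and I1 I2 :: "nat set"
    and lam' lam :: "nat^'d \<Rightarrow> complex"
  assumes "matrix_dilation M"
    and "m = nat \<bar>det M\<bar>"
    and "half_int_vec c"
    and "n \<ge> 1"
    and "digit_set M m s"
    and "\<forall>i\<in>Iset M m s c. rvec (s i) + rvec (s (partner M m s c i)) = 2 *\<^sub>R c"
    and "I1 \<union> I2 = Iset M m s c" and "I1 \<inter> I2 = {}"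
    and "\<forall>i\<in>Iset M m s c. i \<in> I1 \<longleftrightarrow> partner M m s c i \<in> I2"
    and "lam' 0 = 1"
    and "\<forall>\<alpha>\<in>Delta n. odd (mdeg \<alpha>) \<longrightarrow> Re (lam' \<alpha>) = 0"
    and "\<forall>\<alpha>\<in>Delta n. even (mdeg \<alpha>) \<longrightarrow> Im (lam' \<alpha>) = 0"
    and "\<forall>\<alpha>\<in>Delta n. lam \<alpha> =
           (\<Sum>\<gamma> | \<gamma> \<le> \<alpha>. lam' \<gamma> * of_nat (mbinom \<alpha> \<gamma>) * of_real (mpow (Minv M c) (\<alpha> - \<gamma>)))"
  shows "\<exists>m0.
    is_mask m0 \<and> symmetric_b c m0 \<and>
    (\<exists>\<mu>. polyphase M m s m0 \<mu> \<and>
      (\<forall>\<beta>\<in>Delta n. \<forall>k<m. mderiv \<beta> (\<mu> k) 0 =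
         (2 * of_real pi * \<i>) ^ mdeg \<beta> / of_real (sqrt (real m)) *
         (\<Sum>\<alpha> | \<alpha> \<le> \<beta>. lam \<alpha> * of_nat (mbinom \<beta> \<alpha>) *
            of_real (mpow (- Minv M (rvec (s k))) (\<beta> - \<alpha>))))) \<and>
    (\<exists>G GB.
      (\<forall>\<beta>\<in>Delta n. \<forall>i\<in>I1. trig_poly (G \<beta> i) \<and> G \<beta> i \<in> Theta \<beta> n) \<and>
      (\<forall>\<beta>\<in>Delta n. \<forall>j\<in>Jset M m s c.
         semi_trig_poly (Minv M (c - rvec (s j)) - rvec (floor_vec (Minv M (c - rvec (s j))))) (GB \<beta> j) \<and>
         GB \<beta> j \<in> ThetaB \<beta> n) \<and>
      (\<forall>\<xi>. m0 \<xi> =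
         1 / of_nat m * (\<Sum>j\<in>Jset M m s c. \<Sum>\<beta>\<in>Delta n.
            lam' \<beta> * GB \<beta> j (Mstar M \<xi>) * expw c \<xi>) +
         1 / of_nat m * (\<Sum>i\<in>I1.
            (\<Sum>\<beta>\<in>Delta n.
               (\<Sum>\<gamma> | \<gamma> \<le> \<beta>. lam' \<gamma> * of_nat (mbinom \<beta> \<gamma>) *
                  of_real (mpow (Minv M c - Minv M (rvec (s i))) (\<beta> - \<gamma>))) *
               G \<beta> i (Mstar M \<xi>) * expw (rvec (s i)) \<xi>) +
            (\<Sum>\<beta>\<in>Delta n.
               (\<Sum>\<gamma> | \<gamma> \<le> \<beta>. cnj (lam' \<gamma>) * of_nat (mbinom \<beta> \<gamma>) *
                  of_real (mpow (Minv M c - Minv M (rvec (s i))) (\<beta> - \<gamma>))) *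
               cnj (G \<beta> i (Mstar M \<xi>)) * expw (2 *\<^sub>R c - rvec (s i)) \<xi>))))"
proof -
  let ?p = "partner M m s c" and ?J = "Jset M m s c" and ?I = "Iset M m s c"
  \<comment> \<open>The parameter of the binomial shift belonging to the digit \<open>s k\<close>.\<close>
  define a where "a k = Minv M (c - rvec (s k))" for k
  define \<sigma> where "\<sigma> j = a j - rvec (floor_vec (a j))" for j
  have inv: "invertible (rmat M)"
    using assms(1) by (rule matrix_dilation_invertible)
  note p_props = partner_props[OF inv assms(5) assms(3)]
  have "m > 0" using p_props(1) gr_zeroI by fastforce

  have I1: "i \<in> ?I" "?p i \<in> I2" if "i \<in> I1" for i
    using that assms(7,9) by auto
  have I2: "i \<in> ?I" "i \<notin> I1" "?p i \<in> I1" if "i \<in> I2" for i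
  proof -
    show I: "i \<in> ?I" "i \<notin> I1" using that assms(7,8) by auto
    then have "?p i \<in> ?I" "?p (?p i) = i"
      using p_props by (auto simp: Iset_def)
    with assms(9) that show "?p i \<in> I1" by auto
  qed
  have J_half: "half_int_vec (a j)" if "j \<in> ?J" for j
  proof -
    have "2 *\<^sub>R c - rvec (s j) - rvec (s j) = 2 *\<^sub>R (c - rvec (s j))"
      by (simp add: scaleR_2 algebra_simps)
    then have "int_vec (2 *\<^sub>R a j)"
      using that p_props(2)[of j] by (simp add: Jset_def a_def Minv_scaleR)
    then show ?thesis by (simp add: half_int_vec_def int_vec_def)
  qed
  have partner_s: "rvec (s (?p i)) = 2 *\<^sub>R c - rvec (s i)" if "i \<in> ?I" for i
    using assms(6) that by (simp add: algebra_simps)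
  have partner_a: "a (?p i) = - a i" if "i \<in> ?I" for i
    using partner_s[OF that]
    by (simp add: a_def Minv_diff Minv_scaleR scaleR_2)

  \<comment> \<open>One family \<open>G\<close> serves all pairs, since its frequencies are integral whatever the digit is.\<close>
  have "\<forall>\<beta> :: nat^'d. \<exists>t. t \<in> trig_span (range rvec) \<and> (\<forall>\<alpha>\<in>Delta n. moment t \<alpha> = (if \<alpha> = \<beta> then 1 else 0))"
    using exists_dual_to_moments[where \<sigma> = 0] unfolding add_0_right by blast
  from choice[OF this] obtain G :: "nat^'d \<Rightarrow> real^'d \<Rightarrow> complex"
    where G: "\<And>\<beta>. G \<beta> \<in> trig_span (range rvec)"
    and G_moment: "\<And>\<beta> \<alpha>. \<alpha> \<in> Delta n \<Longrightarrow> moment (G \<beta>) \<alpha> = (if \<alpha> = \<beta> then 1 else 0)"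
    by blast
  have "\<forall>x. \<exists>t. snd x \<in> ?J \<longrightarrow> t \<in> trig_span (range (\<lambda>k. rvec k + \<sigma> (snd x)))
    \<and> (\<forall>\<alpha>\<in>Delta n. moment t \<alpha> = (if \<alpha> = fst x then 1 else 0))
    \<and> (\<forall>\<xi>. t \<xi> = (-1) ^ mdeg (fst x) * cnj (t \<xi>))"
    using exists_symmetric_dual_to_moments[OF frac_half_int_vec(1)[OF J_half]] unfolding \<sigma>_def by blast
  from choice[OF this] obtain H where H: "\<forall>x. snd x \<in> ?J \<longrightarrow> H x \<in> trig_span (range (\<lambda>k. rvec k + \<sigma> (snd x)))
    \<and> (\<forall>\<alpha>\<in>Delta n. moment (H x) \<alpha> = (if \<alpha> = fst x then 1 else 0))
    \<and> (\<forall>\<xi>. H x \<xi> = (-1) ^ mdeg (fst x) * cnj (H x \<xi>))" ..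
  define GB where "GB \<beta> j = H (\<beta>, j)" for \<beta> j
  have GB: "\<And>\<beta> j. j \<in> ?J \<Longrightarrow> GB \<beta> j \<in> trig_span (range (\<lambda>k. rvec k + \<sigma> j))"
    and GB_moment: "\<And>\<beta> \<alpha> j. j \<in> ?J \<Longrightarrow> \<alpha> \<in> Delta n \<Longrightarrow> moment (GB \<beta> j) \<alpha> = (if \<alpha> = \<beta> then 1 else 0)"
    and GB_sym: "\<And>\<beta> j \<xi>. j \<in> ?J \<Longrightarrow> GB \<beta> j \<xi> = (-1) ^ mdeg \<beta> * cnj (GB \<beta> j \<xi>)"
    using H[THEN spec, of "(_, _)"] unfolding GB_def fst_conv snd_conv by blast+

  \<comment> \<open>\<open>\<nu> k\<close> is \<open>\<surd>m\<close> times the polyphase component, and \<open>T k\<close> is the part of \<open>m \<cdot> m0\<close> whose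
      frequencies are congruent to \<open>s k\<close>.\<close>
  define \<nu>J where "\<nu>J j \<xi> = (\<Sum>\<beta>\<in>Delta n. lam' \<beta> * GB \<beta> j \<xi>) * expw (a j) \<xi>" for j \<xi>
  define \<nu>I where "\<nu>I i \<xi> = (\<Sum>\<beta>\<in>Delta n. binom_shift lam' (a i) \<beta> * G \<beta> \<xi>)" for i \<xi>
  define \<nu> where "\<nu> k = (if k \<in> ?J then \<nu>J k else if k \<in> I1 then \<nu>I k
    else (\<lambda>\<xi>. cnj (\<nu>I (?p k) \<xi>)))" for k
  define \<mu> where "\<mu> k \<xi> = 1 / of_real (sqrt (real m)) * \<nu> k \<xi>" for k \<xi>
  define T where "T k \<xi> = expw (rvec (s k)) \<xi> * \<nu> k (Mstar M \<xi>)" for k \<xi>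
  define m0 where "m0 \<xi> = 1 / of_nat m * (\<Sum>k<m. T k \<xi>)" for \<xi>

  have disjoint: "?J \<inter> ?I = {}" by (auto simp: Jset_def Iset_def)
  have \<nu>_J: "\<nu> k = \<nu>J k" if "k \<in> ?J" for k using that by (simp add: \<nu>_def)
  have \<nu>_I1: "\<nu> k = \<nu>I k" if "k \<in> I1" for k
    using that I1(1)[OF that] disjoint by (auto simp: \<nu>_def)
  have \<nu>_I2: "\<nu> k = (\<lambda>\<xi>. cnj (\<nu>I (?p k) \<xi>))" if "k \<in> I2" for k
    using that I2(1,2)[OF that] disjoint by (auto simp: \<nu>_def)
  have less_cases: "k \<in> ?J \<or> k \<in> I1 \<or> k \<in> I2" if "k < m" for k
    using that assms(7) by (auto simp: Jset_def Iset_def)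

  have parity: "(-1) ^ mdeg \<alpha> * cnj (lam' \<alpha>) = lam' \<alpha>" if "\<alpha> \<in> Delta n" for \<alpha>
    using assms(11,12) that by (cases "even (mdeg \<alpha>)") (auto simp: complex_eq_iff)

  have \<nu>I: "\<nu>I i \<in> trig_span (range rvec)"
    and \<nu>I_moment: "\<beta> \<in> Delta n \<Longrightarrow> moment (\<nu>I i) \<beta> = binom_shift lam' (a i) \<beta>" for i \<beta>
    using dual_combination[where n = n and G = G and A = "range rvec"
        and l = "binom_shift lam' (a i)"] G G_moment
    unfolding \<nu>I_def[abs_def] by auto
  have \<nu>: "\<nu> k \<in> trig_span (range rvec) \<and> (\<forall>\<beta>\<in>Delta n. moment (\<nu> k) \<beta> = binom_shift lam' (a k) \<beta>)"
    if "k < m" for k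
    using less_cases[OF that]
  proof (elim disjE)
    assume J: "k \<in> ?J"
    let ?g = "\<lambda>\<xi>. \<Sum>\<beta>\<in>Delta n. lam' \<beta> * GB \<beta> k \<xi>"
    have g: "?g \<in> trig_span (range (\<lambda>l. rvec l + \<sigma> k))"
      and g_moment: "\<And>\<alpha>. \<alpha> \<in> Delta n \<Longrightarrow> moment ?g \<alpha> = lam' \<alpha>"
      using dual_combination[where n = n and G = "\<lambda>\<beta>. GB \<beta> k" and l = lam'] GB[OF J] GB_moment[OF J] by auto
    have "rvec l + \<sigma> k + a k \<in> range rvec" for l
    proof (rule image_eqI)
      have "rvec (floor_vec (2 *\<^sub>R a k)) = 2 *\<^sub>R a k"
        using J_half[OF J] by (intro rvec_floor_vec) (simp add: half_int_vec_def int_vec_def)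
      \<comment> \<open>\<open>\<sigma> k\<close> differs from \<open>a k\<close> by an integer vector, so the sum is \<open>2 a k\<close> up to integers.\<close>
      then show "rvec l + \<sigma> k + a k = rvec (l - floor_vec (a k) + floor_vec (2 *\<^sub>R a k))"
        by (simp add: \<sigma>_def rvec_add rvec_diff scaleR_2)
    qed simp
    then have "(\<lambda>\<xi>. ?g \<xi> * expw (a k) \<xi>) \<in> trig_span (range rvec)"
      using g by (intro trig_span_modulate) auto
    moreover have "moment (\<lambda>\<xi>. ?g \<xi> * expw (a k) \<xi>) \<beta> = binom_shift lam' (a k) \<beta>"
      if "\<beta> \<in> Delta n" for \<beta>
      unfolding moment_modulate[OF g]
      using that by (intro binom_shift_cong g_moment) (rule Delta_downward)
    ultimately show ?thesis unfolding \<nu>_J[OF J] \<nu>J_def[abs_def] by blast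
  next
    assume "k \<in> I1"
    then show ?thesis using \<nu>I \<nu>I_moment by (simp add: \<nu>_I1)
  next
    assume k: "k \<in> I2"
    have "(\<lambda>\<xi>. cnj (\<nu>I (?p k) \<xi>)) \<in> trig_span (range rvec)"
      using \<nu>I by (rule trig_span_cnj) (auto simp: rvec_minus[symmetric])
    moreover have "moment (\<lambda>\<xi>. cnj (\<nu>I (?p k) \<xi>)) \<beta> = binom_shift lam' (a k) \<beta>"
      if "\<beta> \<in> Delta n" for \<beta>
    proof -
      have "moment (\<lambda>\<xi>. cnj (\<nu>I (?p k) \<xi>)) \<beta>
          = binom_shift (\<lambda>\<alpha>. (-1) ^ mdeg \<alpha> * cnj (lam' \<alpha>)) (- a (?p k)) \<beta>"
        unfolding moment_cnj[OF \<nu>I] \<nu>I_moment[OF that] cnj_binom_shift binom_shift_minus ..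
      also have "\<dots> = binom_shift lam' (- a (?p k)) \<beta>"
        using that by (intro binom_shift_cong parity) (rule Delta_downward)
      finally show ?thesis using partner_a[OF I2(1)[OF k]] by simp
    qed
    ultimately show ?thesis unfolding \<nu>_I2[OF k] by blast
  qed
  have \<mu>: "\<mu> k \<in> trig_span (range rvec)" if "k < m" for k
    unfolding \<mu>_def[abs_def] using \<nu>[OF that] by (intro trig_span_scale) blast
  have \<mu>_moment: "moment (\<mu> k) \<beta> = 1 / of_real (sqrt (real m)) * binom_shift lam' (a k) \<beta>"
    if "k < m" "\<beta> \<in> Delta n" for k \<beta>
    unfolding \<mu>_def[abs_def] using \<nu>[OF that(1)] that(2) by (metis moment_scale)

  have sqrt_m: "of_real (sqrt (real m)) * of_real (sqrt (real m)) = (of_nat m :: complex)"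
    by (simp flip: of_real_mult)
  have polyphase_m0: "m0 \<xi> = 1 / of_real (sqrt (real m)) * (\<Sum>k<m. expw (rvec (s k)) \<xi> * \<mu> k (Mstar M \<xi>))" for \<xi>
    by (simp add: m0_def T_def \<mu>_def sum_distrib_left sqrt_m[symmetric])
  have polyphase: "polyphase M m s m0 \<mu>"
    using polyphase_m0 \<mu> by (simp add: polyphase_def trig_poly_trig_span)

  have jets: "mderiv \<beta> (\<mu> k) 0 = (2 * of_real pi * \<i>) ^ mdeg \<beta> / of_real (sqrt (real m)) *
         (\<Sum>\<alpha> | \<alpha> \<le> \<beta>. lam \<alpha> * of_nat (mbinom \<beta> \<alpha>) * of_real (mpow (- Minv M (rvec (s k))) (\<beta> - \<alpha>)))"
    if "\<beta> \<in> Delta n" "k < m" for \<beta> k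
  proof -
    have "lam \<alpha> = binom_shift lam' (Minv M c) \<alpha>" if "\<alpha> \<in> Delta n" for \<alpha>
      using assms(13) that by (simp add: binom_shift_def)
    then have "binom_shift lam (- Minv M (rvec (s k))) \<beta>
        = binom_shift (binom_shift lam' (Minv M c)) (- Minv M (rvec (s k))) \<beta>"
      using that(1) by (intro binom_shift_cong) (blast intro: Delta_downward)
    also have "\<dots> = binom_shift lam' (a k) \<beta>"
      by (simp add: binom_shift_add a_def Minv_diff)
    finally show ?thesis
      using \<mu>_moment[OF that(2,1)] by (simp add: mderiv_moment binom_shift_def)
  qed

  have "0 \<in> Delta n" using assms(4) by (simp add: Delta_def mdeg_def)
  \<comment> \<open>Each of the \<open>m\<close> components has the value \<open>\<lambda>' 0 / \<surd>m = 1 / \<surd>m\<close> at the origin.\<close>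
  have "m0 0 = 1"
  proof -
    have "\<mu> k 0 = 1 / of_real (sqrt (real m))" if "k < m" for k
    proof -
      have "{\<gamma> :: nat^'d. \<gamma> \<le> 0} = {0}"
        by (auto simp: less_eq_vec_def vec_eq_iff)
      then have "binom_shift lam' (a k) 0 = 1"
        by (simp add: binom_shift_def mbinom_def mpow_def assms(10))
      then show ?thesis
        using \<mu>_moment[OF that \<open>0 \<in> Delta n\<close>] by (simp add: moment_0)
    qed
    then show ?thesis
      unfolding polyphase_m0 using \<open>m > 0\<close> by (simp add: Mstar_def sqrt_m)
  qed
  moreover have "m0 \<in> trig_span (range rvec)"
  proof -
    have "(\<lambda>\<xi>. \<nu> k (Mstar M \<xi>) * expw (rvec (s k)) \<xi>) \<in> trig_span (range rvec)" if "k < m" for k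
    proof (rule trig_span_modulate)
      show "(\<lambda>\<xi>. \<nu> k (Mstar M \<xi>)) \<in> trig_span (range rvec)"
        using \<nu>[OF that] by (intro trig_span_Mstar[where A = "range rvec"]) (auto simp: rmat_rvec)
    qed (auto simp: rvec_add[symmetric])
    then show ?thesis
      unfolding m0_def[abs_def] T_def[abs_def] mult.commute[of "expw _ _"]
      by (intro trig_span_scale trig_span_sum) auto
  qed
  ultimately have mask: "is_mask m0"
    by (simp add: is_mask_def trig_poly_trig_span)

  have expw_Minv: "expw (Minv M x) (Mstar M \<xi>) = expw x \<xi>" for x \<xi>
    by (simp add: expw_Mstar Minv_rmat[OF inv])
  have T_J: "T j \<xi> = (\<Sum>\<beta>\<in>Delta n. lam' \<beta> * GB \<beta> j (Mstar M \<xi>) * expw c \<xi>)" if "j \<in> ?J" for j \<xi>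
  proof -
    have "expw (rvec (s j)) \<xi> * expw (a j) (Mstar M \<xi>) = expw c \<xi>"
      unfolding a_def expw_Minv expw_add[symmetric] by simp
    moreover have "T j \<xi> = (\<Sum>\<beta>\<in>Delta n. lam' \<beta> * GB \<beta> j (Mstar M \<xi>))
        * (expw (rvec (s j)) \<xi> * expw (a j) (Mstar M \<xi>))"
      unfolding T_def \<nu>_J[OF that] \<nu>J_def by (simp only: mult_ac)
    ultimately show ?thesis by (simp only: sum_distrib_right)
  qed
  have T_partner: "T (?p i) \<xi> = expw (2 *\<^sub>R c) \<xi> * cnj (T i \<xi>)" if "i \<in> ?I" for i \<xi>
  proof -
    have "\<nu> (?p i) = (\<lambda>\<xi>. cnj (\<nu> i \<xi>))"
    proof (cases "i \<in> I1")
      case True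
      have "?p (?p i) = i" using p_props(3) that by (simp add: Iset_def)
      with True I1(2)[OF True] show ?thesis by (simp add: \<nu>_I1 \<nu>_I2)
    next
      case False
      then have "i \<in> I2" using that assms(7) by auto
      with I2(3) show ?thesis by (simp add: \<nu>_I1 \<nu>_I2)
    qed
    then show ?thesis
      by (simp add: T_def partner_s[OF that] expw_add[symmetric] mult.assoc[symmetric])
  qed
  \<comment> \<open>The signs from the parity of \<open>\<lambda>'\<close> and from the class of \<open>GB\<close> cancel, so that
      \<open>T j\<close> is a real factor times \<open>e\<^bsup>2\<pi>i(c,\<xi>)\<^esup>\<close>.\<close>
  have T_J_sym: "T j \<xi> = expw (2 *\<^sub>R c) \<xi> * cnj (T j \<xi>)" if "j \<in> ?J" for j \<xi>
  proof -
    have "lam' \<beta> * GB \<beta> j \<eta> = cnj (lam' \<beta> * GB \<beta> j \<eta>)" if "\<beta> \<in> Delta n" for \<beta> \<eta>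
    proof -
      have "lam' \<beta> * GB \<beta> j \<eta>
          = ((-1) ^ mdeg \<beta> * cnj (lam' \<beta>)) * ((-1) ^ mdeg \<beta> * cnj (GB \<beta> j \<eta>))"
        by (simp only: parity[OF that] GB_sym[OF \<open>j \<in> ?J\<close>, symmetric])
      also have "\<dots> = ((-1) ^ mdeg \<beta> * (-1) ^ mdeg \<beta>) * cnj (lam' \<beta> * GB \<beta> j \<eta>)"
        by (simp add: mult_ac)
      finally show ?thesis by (simp flip: power_mult_distrib)
    qed
    then have real: "cnj (\<Sum>\<beta>\<in>Delta n. lam' \<beta> * GB \<beta> j \<eta>) = (\<Sum>\<beta>\<in>Delta n. lam' \<beta> * GB \<beta> j \<eta>)" for \<eta>
      unfolding cnj_sum by (intro sum.cong) auto
    have "T j \<xi> = (\<Sum>\<beta>\<in>Delta n. lam' \<beta> * GB \<beta> j (Mstar M \<xi>)) * (expw (2 *\<^sub>R c) \<xi> * cnj (expw c \<xi>))"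
      unfolding T_J[OF that] sum_distrib_right[symmetric] cnj_expw expw_add[symmetric] by (simp add: scaleR_2)
    also have "\<dots> = expw (2 *\<^sub>R c) \<xi> * cnj ((\<Sum>\<beta>\<in>Delta n. lam' \<beta> * GB \<beta> j (Mstar M \<xi>)) * expw c \<xi>)"
      unfolding complex_cnj_mult real by (simp only: mult_ac)
    finally show ?thesis unfolding T_J[OF that] sum_distrib_right .
  qed

  have symmetric: "symmetric_b c m0"
    unfolding symmetric_b_def
  proof
    fix \<xi>
    have "(\<Sum>k<m. T k \<xi>) = (\<Sum>k<m. T (?p k) \<xi>)"
      using p_props(1,3) by (intro sum.reindex_bij_witness[of _ ?p ?p]) auto
    also have "\<dots> = (\<Sum>k<m. expw (2 *\<^sub>R c) \<xi> * cnj (T k \<xi>))"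
    proof (intro sum.cong refl)
      fix k assume "k \<in> {..<m}"
      then consider "k \<in> ?J" | "k \<in> ?I" by (auto simp: Jset_def Iset_def)
      then show "T (?p k) \<xi> = expw (2 *\<^sub>R c) \<xi> * cnj (T k \<xi>)"
      proof cases
        case 1
        then have "?p k = k" by (simp add: Jset_def)
        with T_J_sym[OF 1] show ?thesis by simp
      qed (rule T_partner)
    qed
    also have "\<dots> = expw (2 *\<^sub>R c) \<xi> * cnj (\<Sum>k<m. T k \<xi>)"
      by (simp only: sum_distrib_left cnj_sum)
    finally have "m0 \<xi> = 1 / of_nat m * (expw (2 *\<^sub>R c) \<xi> * cnj (\<Sum>k<m. T k \<xi>))"
      unfolding m0_def by (rule arg_cong)
    also have "\<dots> = expw (2 *\<^sub>R c) \<xi> * cnj (m0 \<xi>)"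
      by (simp add: m0_def)
    finally show "m0 \<xi> = expw (2 *\<^sub>R c) \<xi> * cnj (m0 \<xi>)" .
  qed

  have formula: "m0 \<xi> =
         1 / of_nat m * (\<Sum>j\<in>?J. \<Sum>\<beta>\<in>Delta n. lam' \<beta> * GB \<beta> j (Mstar M \<xi>) * expw c \<xi>) +
         1 / of_nat m * (\<Sum>i\<in>I1.
            (\<Sum>\<beta>\<in>Delta n.
               (\<Sum>\<gamma> | \<gamma> \<le> \<beta>. lam' \<gamma> * of_nat (mbinom \<beta> \<gamma>) *
                  of_real (mpow (Minv M c - Minv M (rvec (s i))) (\<beta> - \<gamma>))) *
               G \<beta> (Mstar M \<xi>) * expw (rvec (s i)) \<xi>) +
            (\<Sum>\<beta>\<in>Delta n.
               (\<Sum>\<gamma> | \<gamma> \<le> \<beta>. cnj (lam' \<gamma>) * of_nat (mbinom \<beta> \<gamma>) *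
                  of_real (mpow (Minv M c - Minv M (rvec (s i))) (\<beta> - \<gamma>))) *
               cnj (G \<beta> (Mstar M \<xi>)) * expw (2 *\<^sub>R c - rvec (s i)) \<xi>))" for \<xi>
  proof -
    have fin: "finite ?J" "finite I1" "finite I2"
      using assms(7) by (auto intro: finite_subset[of _ "{..<m}"] simp: Jset_def Iset_def)
    have J_I: "?J \<inter> (I1 \<union> I2) = {}" using assms(7) disjoint by simp
    have split: "{..<m} = ?J \<union> (I1 \<union> I2)"
      unfolding assms(7) by (auto simp: Jset_def Iset_def)
    have "(\<Sum>k<m. T k \<xi>) = (\<Sum>k\<in>?J. T k \<xi>) + ((\<Sum>i\<in>I1. T i \<xi>) + (\<Sum>i\<in>I2. T i \<xi>))"
      unfolding split sum.union_disjoint[OF fin(1) finite_UnI[OF fin(2,3)] J_I]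
        sum.union_disjoint[OF fin(2,3) assms(8)] ..
    also have "(\<Sum>i\<in>I2. T i \<xi>) = (\<Sum>i\<in>I1. T (?p i) \<xi>)"
      using I1 I2 p_props(3) by (intro sum.reindex_bij_witness[of _ ?p ?p]) (auto simp: Iset_def)
    also have "(\<Sum>i\<in>I1. T i \<xi>) + \<dots> = (\<Sum>i\<in>I1.
            (\<Sum>\<beta>\<in>Delta n. binom_shift lam' (a i) \<beta> * G \<beta> (Mstar M \<xi>) * expw (rvec (s i)) \<xi>) +
            (\<Sum>\<beta>\<in>Delta n. binom_shift (\<lambda>\<gamma>. cnj (lam' \<gamma>)) (a i) \<beta> *
               cnj (G \<beta> (Mstar M \<xi>)) * expw (2 *\<^sub>R c - rvec (s i)) \<xi>))"
      unfolding sum.distrib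
    proof (intro arg_cong2[of _ _ _ _ "(+)"] sum.cong refl)
      fix i assume i: "i \<in> I1"
      show T_i: "T i \<xi> = (\<Sum>\<beta>\<in>Delta n. binom_shift lam' (a i) \<beta> * G \<beta> (Mstar M \<xi>) * expw (rvec (s i)) \<xi>)"
        by (simp add: T_def \<nu>_I1[OF i] \<nu>I_def sum_distrib_left mult_ac)
      have "expw (2 *\<^sub>R c - rvec (s i)) \<xi> = expw (2 *\<^sub>R c) \<xi> * cnj (expw (rvec (s i)) \<xi>)"
        by (simp add: expw_add[symmetric])
      then show "T (?p i) \<xi> = (\<Sum>\<beta>\<in>Delta n. binom_shift (\<lambda>\<gamma>. cnj (lam' \<gamma>)) (a i) \<beta> *
               cnj (G \<beta> (Mstar M \<xi>)) * expw (2 *\<^sub>R c - rvec (s i)) \<xi>)"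
        unfolding T_partner[OF I1(1)[OF i]] T_i
        by (simp add: sum_distrib_left cnj_binom_shift mult_ac)
    qed
    finally show ?thesis
      by (simp add: m0_def T_J distrib_left binom_shift_def a_def Minv_diff)
  qed

  have GB_class: "semi_trig_poly (\<sigma> j) (GB \<beta> j) \<and> GB \<beta> j \<in> ThetaB \<beta> n" if "j \<in> ?J" for j \<beta>
  proof -
    have semi: "semi_trig_poly (\<sigma> j) (GB \<beta> j)"
      using GB[OF that] frac_half_int_vec[OF J_half[OF that]]
      unfolding \<sigma>_def by (rule semi_trig_poly_trig_span)
    moreover have "GB \<beta> j \<in> Theta \<beta> n"
      unfolding Theta_iff_moment using semi GB_moment[OF that] by auto
    ultimately show ?thesis using GB_sym[OF that] unfolding ThetaB_def by blast
  qed
  have G_class: "trig_poly (G \<beta>) \<and> G \<beta> \<in> Theta \<beta> n" for \<beta>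
    unfolding Theta_iff_moment trig_poly_def[symmetric]
    using trig_poly_trig_span[OF G] G_moment unfolding trig_poly_def by auto

  show ?thesis
  proof (rule exI[of _ m0], intro conjI mask symmetric, goal_cases)
    case 1
    show ?case
      by (rule exI[of _ \<mu>]) (intro conjI ballI allI impI polyphase jets)
  next
    case 2
    note GB_class' = GB_class[unfolded \<sigma>_def a_def]
    show ?case
      by (rule exI[of _ "\<lambda>\<beta> i. G \<beta>"], rule exI[of _ GB])
        (intro conjI ballI allI formula conjunct1[OF G_class] conjunct2[OF G_class]
          conjunct1[OF GB_class'] conjunct2[OF GB_class'])
  qed
qed

end
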